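(* For the correlated prophet inequality with $n$ rewards under block arrival and target approximation parameter $\varepsilon>0$, the two-phase algorithm $\mathrm{ALG}$ described in the context achieves a $(1-\varepsilon)$-competition complexity of $$(1+o(1))\cdot\left(n+\log\log\frac1\varepsilon\right).$$
   Context: All logarithms are base $2$. Model. $F$ is a known joint distribution over reward sequences $v=(v_1,\dots,v_n)\in\mathbb{R}_{\ge0}^n$ (arbitrary correlations between coordinates allowed). Standing assumptions: $F$ is discrete and every $v$ in its support has a unique maximal coordinate. Given $k$ independent copies $v^{(1)},\dots,v^{(k)}\sim F$ (rounds), the $nk$ rewards are revealed one by one in the order $v^{(1)}_1,\dots,v^{(1)}_n,v^{(2)}_1,\dots,v^{(k)}_n$ (block arrival). A (possibly randomized) online algorithm, knowing $F$, must upon seeing each reward decide irrevocably to select it and stop, or to discard it. $\mathrm{ALG}(v)$ is the selected value ($0$ if none). The $(1-\varepsilon)$-competition complexity of an algorithm $\mathrm{ALG}$ is the smallest positive integer $k(n,\varepsilon)$ such that for every such $F$ and every $k\ge k(n,\varepsilon)$, $\mathbb{E}_{v\sim F^k}[\mathrm{ALG}(v)]\ge(1-\varepsilon)\,\mathbb{E}_{v\sim F}[\max_i v_i]$. Notation. $v_{\le i}=(v_1,\dots,v_i)$. For a prefix $x=(x_1,\dots,x_i)$, $PM(x)=\Pr_{v\sim F}[x_i=\max_j v_j\mid v_{\le i}=x]$. $F^*$ is the distribution of $\max_i v_i$ for $v\sim F$. A $q$-quantile threshold of a distribution $D$ is a value $T$ with $\Pr_{w\sim D}[w<T]\le q\le\Pr_{w\sim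 D}[w\le T]$. $Ber(q)$ is a Bernoulli variable with success probability $q$. The algorithm. Let $T_0$ be a $(1-\frac1n)$-quantile threshold of $F^*$, $m_1=n+1$, $m_2=\lceil\log\log\frac1\varepsilon+\log n\rceil+2$. Phase 1 (the first $m_1$ rounds): in each round $t$ set $A_{t,1}=1$; for $i=1,\dots,n$, upon seeing $v^{(t)}_i$, sample independently $Y_{t,i}\sim Ber(PM(v^{(t)}_{\le i}))$ and $Z_{t,i}\sim Ber\left(1/(n-\sum_{j<i}PM(v^{(t)}_{\le j}))\right)$. If $Y_{t,i}=Z_{t,i}=A_{t,i}=1$, set $A_{t,i+1}=0$ and, if moreover $v^{(t)}_i>T_0$, select $v^{(t)}_i$ and stop; otherwise (if not all three equal $1$) set $A_{t,i+1}=A_{t,i}$. Phase 2 (the next $m_2$ rounds, if nothing was selected in Phase 1): let $p=\Pr_{v\sim F}[\max_j v_j<T_0]$ and, for $i\ge1$, let $T_i$ be a $p^{(2^i)}$-quantile threshold of $F^*$. In the $t$-th round of Phase 2 ($t=1,\dots,m_2$), select the first reward of the round with value at least $T_{\max\{t-2,0\}}$, if any, and stop. *)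

theory Defs
  imports "HOL-Probability.Probability"
begin

text \<open>
  A reward sequence is a list of length \<open>n\<close>, and \<open>v\<^sub>i\<close> is \<open>v ! (i - 1)\<close>. Discreteness of the
  distribution is built into the type of pmfs. The expected maximum is not assumed to be finite;
  expectations are therefore taken in \<open>ennreal\<close>.
\<close>

definition reward_distribution :: "nat \<Rightarrow> real list pmf \<Rightarrow> bool" where
  "reward_distribution n F \<longleftrightarrow>
     (\<forall>v\<in>set_pmf F. length v = n \<and> (\<forall>r\<in>set v. 0 \<le> r) \<and> (\<exists>!i. i < n \<and> v ! i = Max (set v)))"

definition max_distribution :: "real list pmf \<Rightarrow> real pmf" where
  "max_distribution F = map_pmf (\<lambda>v. Max (set v)) F"

definition quantile_threshold :: "real pmf \<Rightarrow> real \<Rightarrow> real \<Rightarrow> bool" where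
  "quantile_threshold D q T \<longleftrightarrow>
     \<P>(w in measure_pmf D. w < T) \<le> q \<and> q \<le> \<P>(w in measure_pmf D. w \<le> T)"

definition PM :: "real list pmf \<Rightarrow> real list \<Rightarrow> real" where
  "PM F x = \<P>(v in measure_pmf F. last x = Max (set v) \<bar> take (length x) v = x)"


text \<open>
  An algorithm maps the distribution and the list of realised rounds to the random reward it
  selects, \<open>None\<close> meaning that nothing is selected.
\<close>

type_synonym algorithm = "real list pmf \<Rightarrow> real list list \<Rightarrow> real option pmf"

definition expected_reward :: "algorithm \<Rightarrow> real list pmf \<Rightarrow> nat \<Rightarrow> ennreal" where
  "expected_reward A F k =
     (\<integral>\<^sup>+ s. ennreal (case s of None \<Rightarrow> 0 | Some r \<Rightarrow> r)
        \<partial>measure_pmf (do { vs \<leftarrow> replicate_pmf k F; A F vs }))"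

definition expected_max :: "real list pmf \<Rightarrow> ennreal" where
  "expected_max F = (\<integral>\<^sup>+ w. ennreal w \<partial>measure_pmf (max_distribution F))"

definition sufficient_rounds :: "nat \<Rightarrow> real \<Rightarrow> algorithm \<Rightarrow> nat \<Rightarrow> bool" where
  "sufficient_rounds n \<epsilon> A K \<longleftrightarrow>
     (\<forall>F. reward_distribution n F \<longrightarrow>
        (\<forall>k\<ge>K. expected_reward A F k \<ge> ennreal (1 - \<epsilon>) * expected_max F))"

definition is_competition_complexity :: "nat \<Rightarrow> real \<Rightarrow> algorithm \<Rightarrow> nat \<Rightarrow> bool" where
  "is_competition_complexity n \<epsilon> A \<kappa> \<longleftrightarrow>
     0 < \<kappa> \<and> sufficient_rounds n \<epsilon> A \<kappa> \<and> (\<forall>K. 0 < K \<and> sufficient_rounds n \<epsilon> A K \<longrightarrow> \<kappa> \<le> K)"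


text \<open>The admissible choices of the thresholds \<open>T\<^sub>0, T\<^sub>1, \<dots>\<close>.\<close>

definition admissible_thresholds :: "nat \<Rightarrow> real list pmf \<Rightarrow> (nat \<Rightarrow> real) \<Rightarrow> bool" where
  "admissible_thresholds n F T \<longleftrightarrow>
     quantile_threshold (max_distribution F) (1 - 1 / real n) (T 0) \<and>
     (let p = \<P>(v in measure_pmf F. Max (set v) < T 0)
      in \<forall>i\<ge>1. quantile_threshold (max_distribution F) (p ^ (2 ^ i)) (T i))"

definition phase1_length :: "nat \<Rightarrow> nat" where
  "phase1_length n = n + 1"

text \<open>
  For \<open>\<epsilon>\<close> close to 1 (relative to \<open>n\<close>) the integer below is negative; then there is no second phase.
\<close>

definition phase2_length :: "nat \<Rightarrow> real \<Rightarrow> nat" where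
  "phase2_length n \<epsilon> = nat (\<lceil>log 2 (log 2 (1 / \<epsilon>)) + log 2 (real n)\<rceil> + 2)"

text \<open>
  One round of the first phase: \<open>a\<close> is the current value of the flag \<open>A\<close>, \<open>xs\<close> are the rewards of
  the round seen so far, and the last argument holds the rewards of the round still to come.
\<close>

fun phase1_round ::
  "nat \<Rightarrow> real list pmf \<Rightarrow> real \<Rightarrow> bool \<Rightarrow> real list \<Rightarrow> real list \<Rightarrow> real option pmf" where
  "phase1_round n F T\<^sub>0 a xs [] = return_pmf None"
| "phase1_round n F T\<^sub>0 a xs (r # rs) =
     do {
       y \<leftarrow> bernoulli_pmf (PM F (xs @ [r]));
       z \<leftarrow> bernoulli_pmf (1 / (real n - (\<Sum>j=1..length xs. PM F (take j xs))));
       if y \<and> z \<and> a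
       then (if r > T\<^sub>0 then return_pmf (Some r) else phase1_round n F T\<^sub>0 False (xs @ [r]) rs)
       else phase1_round n F T\<^sub>0 a (xs @ [r]) rs
     }"

text \<open>
  Round \<open>t = 1, 2, \<dots>\<close> of the two-phase algorithm. The truncated subtraction of natural numbers
  turns the index \<open>max {t - 2, 0}\<close> (with \<open>t\<close> counted within the second phase) into \<open>t - 2\<close>.
\<close>

definition two_phase_round ::
  "nat \<Rightarrow> real \<Rightarrow> (nat \<Rightarrow> real) \<Rightarrow> real list pmf \<Rightarrow> nat \<Rightarrow> real list \<Rightarrow> real option pmf" where
  "two_phase_round n \<epsilon> T F t v =
     (if t \<le> phase1_length n then phase1_round n F (T 0) True [] v
      else if t \<le> phase1_length n + phase2_length n \<epsilon>
      then return_pmf (find (\<lambda>r. r \<ge> T (t - phase1_length n - 2)) v)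
      else return_pmf None)"

fun two_phase_from ::
  "nat \<Rightarrow> real \<Rightarrow> (nat \<Rightarrow> real) \<Rightarrow> real list pmf \<Rightarrow> nat \<Rightarrow> real list list \<Rightarrow> real option pmf" where
  "two_phase_from n \<epsilon> T F t [] = return_pmf None"
| "two_phase_from n \<epsilon> T F t (v # vs) =
     do {
       s \<leftarrow> two_phase_round n \<epsilon> T F t v;
       (case s of Some r \<Rightarrow> return_pmf (Some r) | None \<Rightarrow> two_phase_from n \<epsilon> T F (Suc t) vs)
     }"

text \<open>The rule \<open>T\<close> chooses the thresholds for each distribution.\<close>

definition two_phase_algorithm ::
  "nat \<Rightarrow> real \<Rightarrow> (real list pmf \<Rightarrow> nat \<Rightarrow> real) \<Rightarrow> algorithm" where
  "two_phase_algorithm n \<epsilon> T F vs = two_phase_from n \<epsilon> (T F) F 1 vs"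

end

theory Submission
  imports Defs "HOL-Real_Asymp.Real_Asymp"
begin

text \<open>
  Upper bound. In a round of the first phase the flag \<open>A\<close> is still set before step \<open>i\<close> with
  probability \<open>(n - (\<Sum>j<i. PM\<^sub>j)) / n\<close>, the products of the failure probabilities telescoping. So
  step \<open>i\<close> is accepted with probability \<open>PM\<^sub>i / n\<close>, and averaging over the round gives the
  selected value the law of the maximum restricted to \<open>(T\<^sub>0, \<infinity>)\<close> and scaled by \<open>1 / n\<close>. A round
  selects with probability at most \<open>1 / n\<^sup>2\<close>; hence \<open>n + 1\<close> rounds already give
  \<open>P(ALG > x) \<ge> P(max > x)\<close> for \<open>x \<ge> T\<^sub>0\<close>. In the second phase the bound on the probability of not having
  selected yet is squared from round to round, so that for \<open>x < T\<^sub>0\<close> the threshold \<open>T\<^sub>i\<close> just above \<open>x\<close>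
  gives the same domination, up to a final loss \<open>p\<^bsup>2^(m\<^sub>2 - 1)\<^esup> \<le> \<epsilon>\<close>. Integrating the tails gives
  the claim, also when the expectations are infinite.

  Lower bound. Take \<open>v = (w, 0, \<dots>, 0)\<close> with \<open>w\<close> nearly constant, so that selecting nothing is
  essentially the only loss. If \<open>w = 1\<close> then \<open>T\<^sub>0 = 1\<close> and the strict inequality in the first phase
  never selects. If \<open>w\<close> is uniform on \<open>M\<close> points of \<open>[1, 1 + \<epsilon>]\<close>, every admissible \<open>T\<^sub>i\<close> has
  \<open>P(w < T\<^sub>i) \<ge> p\<^bsup>2^i\<^esup> - 1 / M\<close>, and for large \<open>M\<close> nothing is selected within \<open>n + 1 + m\<close> rounds with
  probability at least \<open>2 * 4\<^bsup>-2^(m + 1)\<^esup>\<close>, which is at least \<open>2\<epsilon>\<close> unless \<open>m + 2 > log log (1/\<epsilon>)\<close>.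
\<close>

section \<open>Independent rounds up to the first selection\<close>

text \<open>Averaging over the rewards turns the algorithm into such a chain, with
  \<open>Q t\<close> the law of the choice made in round \<open>t\<close> alone.\<close>

fun first_some :: "(nat \<Rightarrow> 'a option pmf) \<Rightarrow> nat \<Rightarrow> nat \<Rightarrow> 'a option pmf" where
  "first_some Q t 0 = return_pmf None"
| "first_some Q t (Suc k) =
     do {
       s \<leftarrow> Q t;
       (case s of Some r \<Rightarrow> return_pmf (Some r) | None \<Rightarrow> first_some Q (Suc t) k)
     }"

lemma measure_bind_option:
  assumes "None \<notin> A"
  shows "measure (measure_pmf (bind_pmf q (\<lambda>s. case s of Some r \<Rightarrow> return_pmf (Some r) | None \<Rightarrow> g))) A
    = measure (measure_pmf q) A + pmf q None * measure (measure_pmf g) A"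
proof -
  have "emeasure (measure_pmf (bind_pmf q (\<lambda>s. case s of Some r \<Rightarrow> return_pmf (Some r) | None \<Rightarrow> g))) A
    = (\<integral>\<^sup>+s. (indicator A s + indicator {None} s * emeasure g A) \<partial>q)"
    unfolding emeasure_bind_pmf
    using assms by (intro nn_integral_cong) (auto split: option.splits simp: indicator_def)
  also have "\<dots> = emeasure q A + emeasure q {None} * emeasure g A"
    by (simp add: nn_integral_add nn_integral_multc)
  finally show ?thesis
    by (simp add: measure_pmf.emeasure_eq_measure measure_pmf_single pmf_nonneg
        flip: ennreal_mult ennreal_plus)
qed

lemma pmf_bind_option_None:
  "pmf (bind_pmf q (\<lambda>s. case s of Some r \<Rightarrow> return_pmf (Some r) | None \<Rightarrow> g)) None
    = pmf q None * pmf g None"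
proof -
  have "ennreal (pmf (bind_pmf q (\<lambda>s. case s of Some r \<Rightarrow> return_pmf (Some r) | None \<Rightarrow> g)) None)
    = (\<integral>\<^sup>+s. (indicator {None} s * ennreal (pmf g None)) \<partial>q)"
    unfolding ennreal_pmf_bind
    by (intro nn_integral_cong) (auto split: option.splits simp: indicator_def)
  also have "\<dots> = emeasure q {None} * ennreal (pmf g None)"
    by (simp add: nn_integral_multc)
  finally show ?thesis
    by (simp add: emeasure_pmf_single pmf_nonneg flip: ennreal_mult)
qed

text \<open>Split by the round of the first selection. As \<open>None\<close> is outside
  \<open>A\<close>, running out of rounds contributes nothing.\<close>

lemma measure_first_some:
  assumes "None \<notin> A"
  shows "measure (measure_pmf (first_some Q t k)) A =
    (\<Sum>i<k. (\<Prod>j<i. pmf (Q (t + j)) None) * measure (measure_pmf (Q (t + i))) A)"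
proof (induction k arbitrary: t)
  case 0
  then show ?case using assms by (simp add: measure_return_pmf indicator_def)
next
  case (Suc k)
  show ?case
    by (simp only: first_some.simps measure_bind_option[OF assms] Suc sum.lessThan_Suc_shift
        prod.lessThan_Suc_shift) (simp add: sum_distrib_left mult.assoc)
qed

lemma pmf_first_some_None:
  "pmf (first_some Q t k) None = (\<Prod>i<k. pmf (Q (t + i)) None)"
proof (induction k arbitrary: t)
  case (Suc k)
  show ?case
    by (simp only: first_some.simps pmf_bind_option_None Suc prod.lessThan_Suc_shift) simp
qed simp

lemma set_pmf_first_some:
  "Some r \<in> set_pmf (first_some Q t k) \<Longrightarrow> \<exists>i<k. Some r \<in> set_pmf (Q (t + i))"
proof (induction k arbitrary: t)
  case (Suc k)
  from Suc.prems consider "Some r \<in> set_pmf (Q t)" | "Some r \<in> set_pmf (first_some Q (Suc t) k)"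
    by (auto split: option.splits)
  then show ?case
    by cases (use Suc.IH[of "Suc t"] in force)+
qed simp

lemma measure_first_some_mono:
  assumes "None \<notin> A" "k \<le> l"
  shows "measure (measure_pmf (first_some Q t k)) A \<le> measure (measure_pmf (first_some Q t l)) A"
  unfolding measure_first_some[OF assms(1)]
  by (rule sum_mono2) (use assms(2) in \<open>auto intro!: mult_nonneg_nonneg prod_nonneg\<close>)

text \<open>By \<open>sure\<close>, every selection made in the first \<open>J\<close> rounds lands
  in \<open>A\<close>, so the event can only be missed if all \<open>J\<close> rounds
  decline.\<close>

lemma measure_first_some_ge:
  assumes "None \<notin> A" "J \<le> k"
    and sure: "\<And>i. i < J \<Longrightarrow> measure (measure_pmf (Q (t + i))) A = 1 - pmf (Q (t + i)) None"
  shows "1 - (\<Prod>i<J. pmf (Q (t + i)) None) \<le> measure (measure_pmf (first_some Q t k)) A"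
proof -
  \<comment> \<open>Telescoping: each summand is the drop of the running product in one
    round.\<close>
  have "1 - (\<Prod>i<J. pmf (Q (t + i)) None)
      = (\<Sum>i<J. (\<Prod>j<i. pmf (Q (t + j)) None) * (1 - pmf (Q (t + i)) None))"
    by (induction J) (simp_all add: algebra_simps)
  also have "\<dots> = measure (measure_pmf (first_some Q t J)) A"
    unfolding measure_first_some[OF assms(1)] by (rule sum.cong) (simp_all add: sure)
  finally show ?thesis
    using measure_first_some_mono[OF assms(1,2), of Q t] by simp
qed

section \<open>Comparing expectations through tails\<close>

text \<open>Layer cake: \<open>w\<close> is the length of \<open>[0, w)\<close>, and the two
  integrations are exchanged. A negative \<open>w\<close> gives 0 on both sides, and infinite
  expectations are covered.\<close>

lemma nn_integral_eq_tail:
  "(\<integral>\<^sup>+w. ennreal w \<partial>measure_pmf D)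
    = (\<integral>\<^sup>+x. ennreal (measure (measure_pmf D) {x<..}) * indicator {0..} x \<partial>lborel)"
proof -
  \<comment> \<open>The law is moved to the Borel sets, where joint measurability of the relation
    \<open>x < w\<close> is standard.\<close>
  define M where "M = distr (measure_pmf D) borel (\<lambda>x. x::real)"
  interpret M: prob_space M
    unfolding M_def by (rule measure_pmf.prob_space_distr) simp
  have [measurable_cong]: "sets M = sets borel" by (simp add: M_def)
  interpret pair_sigma_finite M lborel ..
  have "(\<integral>\<^sup>+w. ennreal w \<partial>measure_pmf D) = (\<integral>\<^sup>+w. ennreal w \<partial>M)"
    by (simp add: M_def nn_integral_distr)
  also have "\<dots> = (\<integral>\<^sup>+w. (\<integral>\<^sup>+x. indicator {0..} x * indicator {x<..} w \<partial>lborel) \<partial>M)"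
  proof (rule nn_integral_cong)
    fix w :: real
    have "(\<integral>\<^sup>+x. indicator {0..} x * indicator {x<..} w \<partial>lborel) = (\<integral>\<^sup>+x. indicator {0..<w} x \<partial>lborel)"
      by (intro nn_integral_cong) (auto simp: indicator_def)
    also have "\<dots> = ennreal w"
      by (cases "0 \<le> w") (auto simp: ennreal_neg)
    finally show "ennreal w = (\<integral>\<^sup>+x. indicator {0..} x * indicator {x<..} w \<partial>lborel)" ..
  qed
  also have "\<dots> = (\<integral>\<^sup>+x. (\<integral>\<^sup>+w. indicator {0..} x * indicator {x<..} w \<partial>M) \<partial>lborel)"
    by (rule Fubini'[symmetric]) (simp add: indicator_def, measurable)
  also have "\<dots> = (\<integral>\<^sup>+x. ennreal (measure (measure_pmf D) {x<..}) * indicator {0..} x \<partial>lborel)"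
  proof (rule nn_integral_cong)
    fix x :: real
    have "(\<integral>\<^sup>+w. indicator {0..} x * indicator {x<..} w \<partial>M) = indicator {0..} x * emeasure M {x<..}"
      by (subst nn_integral_cmult) (auto simp: M_def)
    also have "emeasure M {x<..} = emeasure D {x<..}"
      unfolding M_def by (subst emeasure_distr) auto
    finally show "(\<integral>\<^sup>+w. indicator {0..} x * indicator {x<..} w \<partial>M)
        = ennreal (measure (measure_pmf D) {x<..}) * indicator {0..} x"
      by (simp add: measure_pmf.emeasure_eq_measure mult.commute)
  qed
  finally show ?thesis .
qed

lemma nn_integral_mono_tail:
  assumes "0 \<le> c"
    and tail: "\<And>x. 0 \<le> x \<Longrightarrow> c * measure (measure_pmf D) {x<..} \<le> measure (measure_pmf E) {x<..}"
  shows "ennreal c * (\<integral>\<^sup>+w. ennreal w \<partial>measure_pmf D) \<le> (\<integral>\<^sup>+w. ennreal w \<partial>measure_pmf E)"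
proof -
  have meas: "(\<lambda>x. ennreal (measure (measure_pmf D) {x<..}) * indicator {0..} x) \<in> borel_measurable lborel"
  proof -
    have "(\<lambda>x. - measure (measure_pmf D) {x<..}) \<in> borel_measurable borel"
      by (rule borel_measurable_mono) (auto intro!: monoI measure_pmf.finite_measure_mono)
    then have "(\<lambda>x. - (- measure (measure_pmf D) {x<..})) \<in> borel_measurable borel"
      by (rule borel_measurable_uminus)
    then show ?thesis by simp
  qed
  have "ennreal c * (\<integral>\<^sup>+w. ennreal w \<partial>measure_pmf D) =
      (\<integral>\<^sup>+x. ennreal c * (ennreal (measure (measure_pmf D) {x<..}) * indicator {0..} x) \<partial>lborel)"
    unfolding nn_integral_eq_tail[of D] by (rule nn_integral_cmult[symmetric]) (rule meas)
  also have "\<dots> \<le> (\<integral>\<^sup>+x. ennreal (measure (measure_pmf E) {x<..}) * indicator {0..} x \<partial>lborel)"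
  proof (rule nn_integral_mono)
    fix x :: real
    show "ennreal c * (ennreal (measure (measure_pmf D) {x<..}) * indicator {0..} x)
        \<le> ennreal (measure (measure_pmf E) {x<..}) * indicator {0..} x"
      using tail[of x] assms(1) by (auto simp: indicator_def ennreal_leI simp flip: ennreal_mult)
  qed
  finally show ?thesis unfolding nn_integral_eq_tail[of E] .
qed

section \<open>Conditioning on a prefix and the law of a first-phase round\<close>

text \<open>Tower property: \<open>g (X v)\<close> is constant on the fibres of \<open>X\<close>, so
  \<open>f\<close> may be replaced by its conditional mean given \<open>X\<close>.\<close>

lemma nn_integral_pmf_fibres:
  "(\<integral>\<^sup>+v. f v * g (X v) \<partial>measure_pmf F)
    = (\<integral>\<^sup>+v. (\<integral>\<^sup>+u. f u \<partial>measure_pmf (cond_pmf F {u. X u = X v})) * g (X v) \<partial>measure_pmf F)"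
proof -
  have "F = bind_pmf (map_pmf X F) (\<lambda>x. cond_pmf F {u. X u = x})"
    by (rule bind_cond_pmf_cancel[symmetric]) (auto simp: vimage_def intro!: arg_cong[where f = "measure F"])
  then have "(\<integral>\<^sup>+v. f v * g (X v) \<partial>measure_pmf F)
      = (\<integral>\<^sup>+v. f v * g (X v) \<partial>measure_pmf (bind_pmf (map_pmf X F) (\<lambda>x. cond_pmf F {u. X u = x})))"
    by simp
  also have "\<dots> = (\<integral>\<^sup>+v. (\<integral>\<^sup>+u. f u * g (X u) \<partial>measure_pmf (cond_pmf F {u. X u = X v})) \<partial>measure_pmf F)"
    by simp
  also have "\<dots> = (\<integral>\<^sup>+v. (\<integral>\<^sup>+u. f u \<partial>measure_pmf (cond_pmf F {u. X u = X v})) * g (X v) \<partial>measure_pmf F)"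
  proof (rule nn_integral_cong_AE, unfold AE_measure_pmf_iff, rule ballI)
    fix v assume v: "v \<in> set_pmf F"
    then have ne: "set_pmf F \<inter> {u. X u = X v} \<noteq> {}" by auto
    have "(\<integral>\<^sup>+u. f u * g (X u) \<partial>measure_pmf (cond_pmf F {u. X u = X v}))
        = (\<integral>\<^sup>+u. f u * g (X v) \<partial>measure_pmf (cond_pmf F {u. X u = X v}))"
      by (rule nn_integral_cong_AE) (simp add: AE_measure_pmf_iff set_cond_pmf[OF ne])
    also have "\<dots> = (\<integral>\<^sup>+u. f u \<partial>measure_pmf (cond_pmf F {u. X u = X v})) * g (X v)"
      by (simp add: nn_integral_multc)
    finally show "(\<integral>\<^sup>+u. f u * g (X u) \<partial>measure_pmf (cond_pmf F {u. X u = X v})) = \<dots>" .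
  qed
  finally show ?thesis .
qed

text \<open>Translates the conditional probability in \<open>PM\<close> into
  \<open>cond_pmf\<close>, which is meaningful only for events meeting the support.\<close>

lemma cond_prob_eq_measure_cond_pmf:
  assumes "set_pmf F \<inter> {v. Q v} \<noteq> {}"
  shows "\<P>(v in measure_pmf F. P v \<bar> Q v) = measure (measure_pmf (cond_pmf F {v. Q v})) {v. P v}"
proof -
  have "measure (measure_pmf (cond_pmf F {v. Q v})) {v. P v}
      = measure (uniform_measure (measure_pmf F) {v. Q v}) {v. P v}"
    by (simp add: cond_pmf.rep_eq[OF assms])
  also have "\<dots> = measure F ({v. Q v} \<inter> {v. P v}) / measure F {v. Q v}"
    using assms by (intro measure_uniform_measure) (auto simp: emeasure_measure_pmf_not_zero measure_pmf.emeasure_eq_measure measure_measure_pmf_not_zero)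
  finally show ?thesis
    by (auto simp: cond_prob_def Int_def conj_commute)
qed

lemma PM_nonneg: "0 \<le> PM F x"
  by (simp add: PM_def cond_prob_def)

lemma PM_le_1: "PM F x \<le> 1"
  unfolding PM_def cond_prob_def
  by (rule divide_le_eq_1[THEN iffD2])
     (auto simp: less_le intro!: measure_pmf.finite_measure_mono)

lemma sum_PM_le: "(\<Sum>j = 1..l. PM F (take j v)) \<le> real l"
  using sum_mono[of "{1..l}" "\<lambda>j. PM F (take j v)" "\<lambda>_. 1"] by (simp add: PM_le_1)

lemma measure_bind_bernoulli:
  assumes "0 \<le> p" "p \<le> 1"
  shows "measure (measure_pmf (bind_pmf (bernoulli_pmf p) f)) A
    = p * measure (measure_pmf (f True)) A + (1 - p) * measure (measure_pmf (f False)) A"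
proof -
  have "emeasure (measure_pmf (bind_pmf (bernoulli_pmf p) f)) A
    = ennreal (p * measure (measure_pmf (f True)) A + (1 - p) * measure (measure_pmf (f False)) A)"
    unfolding emeasure_bind_pmf using assms
    by (simp add: measure_pmf.emeasure_eq_measure mult.commute flip: ennreal_mult ennreal_plus)
  moreover have "0 \<le> p * measure (measure_pmf (f True)) A + (1 - p) * measure (measure_pmf (f False)) A"
    using assms by (intro add_nonneg_nonneg mult_nonneg_nonneg) auto
  ultimately show ?thesis
    by (simp add: measure_pmf.emeasure_eq_measure del: emeasure_bind_pmf)
qed

lemma phase1_round_False: "phase1_round n F T\<^sub>0 False xs rs = return_pmf None"
  by (induction rs arbitrary: xs) simp_all

lemma set_pmf_phase1_round:
  "Some r \<in> set_pmf (phase1_round n F T\<^sub>0 a xs rs) \<Longrightarrow> T\<^sub>0 < r \<and> r \<in> set rs"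
proof (induction rs arbitrary: a xs)
  case (Cons q rs)
  from Cons.prems consider "T\<^sub>0 < r" "r = q"
    | b ys where "Some r \<in> set_pmf (phase1_round n F T\<^sub>0 b ys rs)"
    by (auto split: if_splits)
  then show ?case
    by cases (auto dest: Cons.IH)
qed simp

text \<open>Started from any prefix \<open>xs\<close> with the flag still set, so that induction on
  the remaining rewards applies. The denominator is what the prefix leaves of the budget
  \<open>n\<close>; the next step accepts with probability \<open>P / D\<close> and otherwise passes
  on a budget of \<open>D - P\<close>, so the factors cancel.\<close>

lemma measure_phase1_round:
  assumes "length xs + length rs = n" "T\<^sub>0 \<le> x"
  shows "measure (measure_pmf (phase1_round n F T\<^sub>0 True xs rs)) (Some ` {x<..}) =
    (\<Sum>i<length rs. PM F (take (Suc (length xs + i)) (xs @ rs)) * indicator {x<..} (rs ! i)) /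
    (real n - (\<Sum>j = 1..length xs. PM F (take j xs)))"
  using assms(1)
proof (induction rs arbitrary: xs)
  case Nil
  then show ?case by (simp add: indicator_def)
next
  case (Cons r rs)
  define P where "P = PM F (xs @ [r])"
  define D where "D = real n - (\<Sum>j = 1..length xs. PM F (take j xs))"
  define S where "S = (\<Sum>i<length rs. PM F (take (Suc (length (xs @ [r]) + i)) ((xs @ [r]) @ rs))
      * indicator {x<..} (rs ! i))"
  define m where "m = measure (measure_pmf (phase1_round n F T\<^sub>0 True (xs @ [r]) rs)) (Some ` {x<..})"
  have P: "0 \<le> P" "P \<le> 1" by (simp_all add: P_def PM_nonneg PM_le_1)
  \<comment> \<open>Fewer than \<open>n\<close> rewards have been seen and each used at most 1 of
    the budget, so \<open>1 / D\<close> is a genuine Bernoulli parameter.\<close>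
  have "1 \<le> D"
    using sum_PM_le[of F xs "length xs"] Cons.prems unfolding D_def by simp
  then have q: "0 \<le> 1 / D" "1 / D \<le> 1" by simp_all
  have D': "real n - (\<Sum>j = 1..length (xs @ [r]). PM F (take j (xs @ [r]))) = D - P"
    by (simp add: D_def P_def)
  have m: "m = S / (D - P)"
    unfolding m_def S_def D'[symmetric] by (rule Cons.IH) (use Cons.prems in simp)
  \<comment> \<open>The budget can run out: if \<open>D = P\<close> the quotient is 0 by convention.
    Then both are 1, which forces \<open>xs\<close> to have length \<open>n - 1\<close>, so no
    reward is left and \<open>S\<close> is 0 as well.\<close>
  have DP: "(D - P) * m = S"
  proof (cases "D = P")
    case True
    then have "D = 1" using P \<open>1 \<le> D\<close> by simp
    then have "real n \<le> real (length xs) + 1"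
      using sum_PM_le[of F xs "length xs"] unfolding D_def by simp
    then have "rs = []" using Cons.prems by (cases rs) auto
    then show ?thesis by (simp add: m S_def)
  qed (simp add: m)
  define R where "R = (if T\<^sub>0 < r then return_pmf (Some r)
      else phase1_round n F T\<^sub>0 False (xs @ [r]) rs)"
  \<comment> \<open>A reward above \<open>x\<close> passes the threshold test because
    \<open>T\<^sub>0\<close> is at most \<open>x\<close>; an accepted reward that fails the test
    kills the round.\<close>
  have sel: "measure (measure_pmf R) (Some ` {x<..}) = indicator {x<..} r"
    using assms(2) by (auto simp: R_def phase1_round_False indicator_def)
  have "measure (measure_pmf (phase1_round n F T\<^sub>0 True xs (r # rs))) (Some ` {x<..}) =
      P * (1 / D * indicator {x<..} r + (1 - 1 / D) * m) + (1 - P) * (1 / D * m + (1 - 1 / D) * m)"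
    unfolding phase1_round.simps P_def[symmetric] D_def[symmetric] R_def[symmetric]
    by (simp only: measure_bind_bernoulli[OF P] measure_bind_bernoulli[OF q] sel m_def simp_thms if_True if_False)
  also have "\<dots> = (P * indicator {x<..} r + (D - P) * m) / D"
    using \<open>1 \<le> D\<close> by (simp add: field_simps)
  also have "\<dots> = (P * indicator {x<..} r + S) / D" by (simp only: DP)
  also have "P * indicator {x<..} r + S =
      (\<Sum>i<length (r # rs). PM F (take (Suc (length xs + i)) (xs @ r # rs)) * indicator {x<..} ((r # rs) ! i))"
    by (simp add: sum.lessThan_Suc_shift P_def S_def del: sum.lessThan_Suc)
  finally show ?case unfolding D_def .
qed

text \<open>\<open>PM\<close> is the conditional mean of the indicator that position
  \<open>i\<close> carries the maximum, and \<open>v ! i\<close> is the last entry of the prefix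
  conditioned on, so the tower property applies.\<close>

lemma nn_integral_PM:
  assumes len: "\<And>v. v \<in> set_pmf F \<Longrightarrow> length v = n" and "i < n"
  shows "(\<integral>\<^sup>+v. ennreal (PM F (take (Suc i) v)) * indicator {x<..} (v ! i) \<partial>measure_pmf F)
    = (\<integral>\<^sup>+v. indicator {v. v ! i = Max (set v)} v * indicator {x<..} (v ! i) \<partial>measure_pmf F)"
proof -
  define X :: "real list \<Rightarrow> real list" where "X = take (Suc i)"
  define f where "f u = (indicator {u. last (X u) = Max (set u)} u :: ennreal)" for u
  define g where "g y = (indicator {x<..} (last y) :: ennreal)" for y :: "real list"
  have last: "last (X v) = v ! i" if "v \<in> set_pmf F" for v
    using len[OF that] \<open>i < n\<close> by (simp add: X_def take_Suc_conv_app_nth)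
  have "(\<integral>\<^sup>+v. ennreal (PM F (take (Suc i) v)) * indicator {x<..} (v ! i) \<partial>measure_pmf F)
      = (\<integral>\<^sup>+v. (\<integral>\<^sup>+u. f u \<partial>measure_pmf (cond_pmf F {u. X u = X v})) * g (X v) \<partial>measure_pmf F)"
  proof (rule nn_integral_cong_AE, unfold AE_measure_pmf_iff, rule ballI)
    fix v assume v: "v \<in> set_pmf F"
    then have ne: "set_pmf F \<inter> {u. X u = X v} \<noteq> {}" by auto
    have "length (X v) = Suc i" using len[OF v] \<open>i < n\<close> by (simp add: X_def)
    then have "PM F (X v) = \<P>(u in measure_pmf F. last (X v) = Max (set u) \<bar> X u = X v)"
      unfolding PM_def by (simp add: X_def)
    also have "\<dots> = measure (measure_pmf (cond_pmf F {u. X u = X v})) {u. last (X v) = Max (set u)}"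
      by (rule cond_prob_eq_measure_cond_pmf[OF ne])
    finally have "ennreal (PM F (X v))
        = (\<integral>\<^sup>+u. indicator {u. last (X v) = Max (set u)} u \<partial>measure_pmf (cond_pmf F {u. X u = X v}))"
      by (simp add: measure_pmf.emeasure_eq_measure)
    also have "\<dots> = (\<integral>\<^sup>+u. f u \<partial>measure_pmf (cond_pmf F {u. X u = X v}))"
      by (rule nn_integral_cong_AE) (auto simp: AE_measure_pmf_iff set_cond_pmf[OF ne] f_def indicator_def)
    finally show "ennreal (PM F (take (Suc i) v)) * indicator {x<..} (v ! i)
        = (\<integral>\<^sup>+u. f u \<partial>measure_pmf (cond_pmf F {u. X u = X v})) * g (X v)"
      by (simp add: g_def last[OF v]) (simp add: X_def)
  qed
  also have "\<dots> = (\<integral>\<^sup>+v. f v * g (X v) \<partial>measure_pmf F)"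
    by (rule nn_integral_pmf_fibres[symmetric])
  also have "\<dots> = (\<integral>\<^sup>+v. indicator {v. v ! i = Max (set v)} v * indicator {x<..} (v ! i) \<partial>measure_pmf F)"
    by (rule nn_integral_cong_AE) (auto simp: AE_measure_pmf_iff f_def g_def last indicator_def)
  finally show ?thesis .
qed

text \<open>Position \<open>i\<close> contributes \<open>1 / n\<close> times the probability that it
  carries the maximum and exceeds \<open>x\<close>. As the maximal coordinate is unique, these
  events partition the event that the maximum exceeds \<open>x\<close>.\<close>

lemma measure_phase1_law:
  assumes rd: "reward_distribution n F" and "1 \<le> n" "T\<^sub>0 \<le> x"
  shows "measure (measure_pmf (bind_pmf F (phase1_round n F T\<^sub>0 True []))) (Some ` {x<..})
    = measure (measure_pmf (max_distribution F)) {x<..} / real n"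
proof -
  have len: "length v = n" if "v \<in> set_pmf F" for v
    using rd that by (auto simp: reward_distribution_def)
  have "ennreal (real n) * emeasure (measure_pmf (bind_pmf F (phase1_round n F T\<^sub>0 True []))) (Some ` {x<..})
      = (\<integral>\<^sup>+v. ennreal (real n) * emeasure (phase1_round n F T\<^sub>0 True [] v) (Some ` {x<..}) \<partial>measure_pmf F)"
    by (simp add: nn_integral_cmult)
  also have "\<dots> = (\<integral>\<^sup>+v. (\<Sum>i<n. ennreal (PM F (take (Suc i) v)) * indicator {x<..} (v ! i)) \<partial>measure_pmf F)"
  proof (rule nn_integral_cong_AE, unfold AE_measure_pmf_iff, rule ballI)
    fix v assume v: "v \<in> set_pmf F"
    have "emeasure (phase1_round n F T\<^sub>0 True [] v) (Some ` {x<..})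
        = ennreal ((\<Sum>i<n. PM F (take (Suc i) v) * indicator {x<..} (v ! i)) / real n)"
      using measure_phase1_round[of "[]" v n T\<^sub>0 x F] len[OF v] assms(3)
      by (simp add: measure_pmf.emeasure_eq_measure)
    then have "ennreal (real n) * emeasure (phase1_round n F T\<^sub>0 True [] v) (Some ` {x<..})
        = ennreal (\<Sum>i<n. PM F (take (Suc i) v) * indicator {x<..} (v ! i))"
      using \<open>1 \<le> n\<close> by (simp add: sum_nonneg PM_nonneg flip: ennreal_mult)
    also have "\<dots> = (\<Sum>i<n. ennreal (PM F (take (Suc i) v)) * indicator {x<..} (v ! i))"
      by (subst sum_ennreal[symmetric])
         (auto simp: PM_nonneg indicator_def intro!: sum.cong)
    finally show "ennreal (real n) * emeasure (phase1_round n F T\<^sub>0 True [] v) (Some ` {x<..}) = \<dots>" .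
  qed
  also have "\<dots> = (\<Sum>i<n. \<integral>\<^sup>+v. ennreal (PM F (take (Suc i) v)) * indicator {x<..} (v ! i) \<partial>measure_pmf F)"
    by (rule nn_integral_sum) simp
  also have "\<dots> = (\<Sum>i<n. \<integral>\<^sup>+v. indicator {v. v ! i = Max (set v)} v * indicator {x<..} (v ! i) \<partial>measure_pmf F)"
    by (rule sum.cong) (auto intro: nn_integral_PM[OF len])
  also have "\<dots> = (\<integral>\<^sup>+v. (\<Sum>i<n. indicator {v. v ! i = Max (set v)} v * indicator {x<..} (v ! i)) \<partial>measure_pmf F)"
    by (rule nn_integral_sum[symmetric]) simp
  also have "\<dots> = (\<integral>\<^sup>+v. indicator {v. x < Max (set v)} v \<partial>measure_pmf F)"
  proof (rule nn_integral_cong_AE, unfold AE_measure_pmf_iff, rule ballI)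
    fix v assume v: "v \<in> set_pmf F"
    have "\<exists>!i. i < n \<and> v ! i = Max (set v)"
      using rd v by (simp add: reward_distribution_def)
    then obtain k where k: "k < n" "v ! k = Max (set v)"
      and uniq: "\<And>i. i < n \<Longrightarrow> v ! i = Max (set v) \<Longrightarrow> i = k"
      by (elim ex1E) blast
    have "(\<Sum>i<n. indicator {v. v ! i = Max (set v)} v * indicator {x<..} (v ! i) :: ennreal)
        = (\<Sum>i<n. if i = k then indicator {v. x < Max (set v)} v else 0)"
    proof (rule sum.cong[OF refl])
      fix i assume i: "i \<in> {..<n}"
      show "indicator {v. v ! i = Max (set v)} v * indicator {x<..} (v ! i)
          = (if i = k then indicator {v. x < Max (set v)} v else 0 :: ennreal)"
      proof (cases "i = k")
        case True
        then show ?thesis by (simp add: k indicator_def)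
      next
        case False
        then have "v ! i \<noteq> Max (set v)" using uniq[of i] i by auto
        then show ?thesis using False by simp
      qed
    qed
    then show "(\<Sum>i<n. indicator {v. v ! i = Max (set v)} v * indicator {x<..} (v ! i) :: ennreal)
        = indicator {v. x < Max (set v)} v"
      using k by simp
  qed
  also have "\<dots> = emeasure (measure_pmf (max_distribution F)) {x<..}"
    by (simp add: max_distribution_def vimage_def)
  finally have "real n * measure (measure_pmf (bind_pmf F (phase1_round n F T\<^sub>0 True []))) (Some ` {x<..})
      = measure (measure_pmf (max_distribution F)) {x<..}"
    by (simp add: measure_pmf.emeasure_eq_measure del: emeasure_bind_pmf flip: ennreal_mult)
  then show ?thesis
    using \<open>1 \<le> n\<close> by (simp add: nonzero_eq_divide_eq mult.commute)
qed

section \<open>The algorithm as a chain of independent rounds\<close>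

definition round_law ::
  "nat \<Rightarrow> real \<Rightarrow> (nat \<Rightarrow> real) \<Rightarrow> real list pmf \<Rightarrow> nat \<Rightarrow> real option pmf" where
  "round_law n \<epsilon> T F t = bind_pmf F (two_phase_round n \<epsilon> T F t)"

text \<open>The choice in round \<open>t\<close> uses only that round's rewards, so the draws of
  later rounds can be postponed until after it.\<close>

lemma bind_replicate_two_phase_from:
  "bind_pmf (replicate_pmf k F) (two_phase_from n \<epsilon> T F t) = first_some (round_law n \<epsilon> T F) t k"
proof (induction k arbitrary: t)
  case 0
  then show ?case by (simp add: bind_return_pmf)
next
  case (Suc k)
  have "bind_pmf (replicate_pmf (Suc k) F) (two_phase_from n \<epsilon> T F t)
      = bind_pmf F (\<lambda>v. bind_pmf (replicate_pmf k F) (\<lambda>vs. bind_pmf (two_phase_round n \<epsilon> T F t v)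
          (\<lambda>s. case s of Some r \<Rightarrow> return_pmf (Some r) | None \<Rightarrow> two_phase_from n \<epsilon> T F (Suc t) vs)))"
    by (simp add: bind_assoc_pmf bind_return_pmf)
  also have "\<dots> = bind_pmf F (\<lambda>v. bind_pmf (two_phase_round n \<epsilon> T F t v) (\<lambda>s. bind_pmf (replicate_pmf k F)
          (\<lambda>vs. case s of Some r \<Rightarrow> return_pmf (Some r) | None \<Rightarrow> two_phase_from n \<epsilon> T F (Suc t) vs)))"
    by (subst bind_commute_pmf) (rule refl)
  also have "\<dots> = bind_pmf (round_law n \<epsilon> T F t) (\<lambda>s. bind_pmf (replicate_pmf k F)
          (\<lambda>vs. case s of Some r \<Rightarrow> return_pmf (Some r) | None \<Rightarrow> two_phase_from n \<epsilon> T F (Suc t) vs))"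
    by (simp add: round_law_def bind_assoc_pmf)
  also have "\<dots> = first_some (round_law n \<epsilon> T F) t (Suc k)"
    by (auto intro!: bind_pmf_cong simp: Suc split: option.splits)
  finally show ?case .
qed

definition reward_law ::
  "nat \<Rightarrow> real \<Rightarrow> (nat \<Rightarrow> real) \<Rightarrow> real list pmf \<Rightarrow> nat \<Rightarrow> real option pmf" where
  "reward_law n \<epsilon> T F k = first_some (round_law n \<epsilon> T F) 1 k"

lemma expected_reward_two_phase:
  "expected_reward (two_phase_algorithm n \<epsilon> T) F k =
    (\<integral>\<^sup>+s. ennreal (case s of None \<Rightarrow> 0 | Some r \<Rightarrow> r) \<partial>measure_pmf (reward_law n \<epsilon> (T F) F k))"
  unfolding expected_reward_def reward_law_def bind_replicate_two_phase_from[symmetric]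
  by (simp add: two_phase_algorithm_def[abs_def])

lemma measure_Some_image_sure:
  assumes "\<And>r. Some r \<in> set_pmf q \<Longrightarrow> r \<in> B"
  shows "measure (measure_pmf q) (Some ` B) = 1 - pmf q None"
proof -
  have "measure (measure_pmf q) (Some ` B) = measure (measure_pmf q) (UNIV - {None})"
  proof (rule measure_pmf.finite_measure_eq_AE, unfold AE_measure_pmf_iff, rule ballI)
    fix s assume "s \<in> set_pmf q"
    then show "s \<in> Some ` B \<longleftrightarrow> s \<in> UNIV - {None}"
      using assms by (cases s) auto
  qed simp_all
  also have "\<dots> = 1 - pmf q None"
    using measure_pmf.prob_compl[of "{None}" q] by (simp add: measure_pmf_single)
  finally show ?thesis .
qed

lemma prod_lessThan_add:
  fixes f :: "nat \<Rightarrow> 'a :: comm_monoid_mult"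
  shows "(\<Prod>i<a + b. f i) = (\<Prod>i<a. f i) * (\<Prod>i<b. f (a + i))"
  by (induction b) (simp_all add: mult.assoc)

lemma reward_distribution_pos:
  assumes "reward_distribution n F"
  shows "0 < n"
proof -
  obtain v where "v \<in> set_pmf F" using set_pmf_not_empty[of F] by blast
  then show ?thesis using assms by (auto simp: reward_distribution_def)
qed

lemma quantile_threshold_iff:
  "quantile_threshold D q \<tau> \<longleftrightarrow>
    measure (measure_pmf D) {..<\<tau>} \<le> q \<and> q \<le> measure (measure_pmf D) {..\<tau>}"
  by (simp add: quantile_threshold_def lessThan_def atMost_def)

lemma measure_greaterThan_eq:
  "measure (measure_pmf D) {x<..} = 1 - measure (measure_pmf D) {..x :: real}"
proof -
  have "{x<..} = UNIV - {..x}" by auto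
  then show ?thesis using measure_pmf.prob_compl[of "{..x}" D] by simp
qed

section \<open>Domination of the tail of the maximum\<close>

locale two_phase =
  fixes n :: nat and \<epsilon> :: real and T :: "nat \<Rightarrow> real" and F :: "real list pmf"
  assumes rd: "reward_distribution n F"
    and thr: "admissible_thresholds n F T"
begin

abbreviation "D \<equiv> measure_pmf (max_distribution F)"

definition p :: real where "p = measure D {..<T 0}"

lemma n_pos: "0 < n"
  using rd by (rule reward_distribution_pos)

lemma p_nonneg: "0 \<le> p" and p_le_1: "p \<le> 1"
  by (simp_all add: p_def)

lemma p_le: "p \<le> 1 - 1 / real n"
  using thr by (simp add: admissible_thresholds_def quantile_threshold_iff p_def)

lemma quantile_T: "1 \<le> i \<Longrightarrow> quantile_threshold (max_distribution F) (p ^ (2 ^ i)) (T i)"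
  using thr unfolding admissible_thresholds_def Let_def
  by (simp add: p_def max_distribution_def vimage_def lessThan_def)

text \<open>Index 0 fits the same pattern because \<open>p ^ (2 ^ 0)\<close> is \<open>p\<close>,
  the mass strictly below \<open>T 0\<close>.\<close>

lemma below_T: "measure D {..<T i} \<le> p ^ (2 ^ i)"
  using quantile_T[of i] by (cases "i = 0") (simp_all add: quantile_threshold_iff p_def)

lemma upto_T: "p ^ (2 ^ i) \<le> measure D {..T i}"
proof (cases "i = 0")
  case True
  have "p \<le> measure D {..T 0}"
    unfolding p_def by (rule measure_pmf.finite_measure_mono) auto
  then show ?thesis using True by simp
qed (use quantile_T[of i] in \<open>simp_all add: quantile_threshold_iff\<close>)

lemma above_T0: "measure D {T 0<..} \<le> 1 / real n"
  using thr by (simp add: admissible_thresholds_def quantile_threshold_iff measure_greaterThan_eq)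

lemma round_law_phase1:
  "t \<le> n + 1 \<Longrightarrow> round_law n \<epsilon> T F t = bind_pmf F (phase1_round n F (T 0) True [])"
  unfolding round_law_def
  by (rule bind_pmf_cong) (simp_all add: two_phase_round_def phase1_length_def)

text \<open>Here \<open>j\<close> counts the rounds of the second phase from 0, so the truncated
  \<open>j - 1\<close> is the required index and both \<open>j = 0\<close> and \<open>j = 1\<close>
  use \<open>T 0\<close>.\<close>

lemma round_law_phase2:
  "j < phase2_length n \<epsilon> \<Longrightarrow>
    round_law n \<epsilon> T F (n + 2 + j) = map_pmf (find (\<lambda>r. T (j - 1) \<le> r)) F"
  unfolding round_law_def map_pmf_def
  by (rule bind_pmf_cong) (simp_all add: two_phase_round_def phase1_length_def)

lemma round_law_late:
  "phase2_length n \<epsilon> \<le> j \<Longrightarrow> round_law n \<epsilon> T F (n + 2 + j) = return_pmf None"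
  unfolding round_law_def two_phase_round_def by (simp add: phase1_length_def)

lemma measure_round_law_phase1:
  assumes "t \<le> n + 1" "T 0 \<le> x"
  shows "measure (measure_pmf (round_law n \<epsilon> T F t)) (Some ` {x<..}) = measure D {x<..} / real n"
  unfolding round_law_phase1[OF assms(1)]
  by (rule measure_phase1_law) (use rd n_pos assms in auto)

lemma phase1_above_T0:
  "t \<le> n + 1 \<Longrightarrow> Some r \<in> set_pmf (round_law n \<epsilon> T F t) \<Longrightarrow> T 0 < r"
  by (auto simp: round_law_phase1 dest: set_pmf_phase1_round)

lemma pmf_phase1_None:
  assumes "t \<le> n + 1"
  shows "pmf (round_law n \<epsilon> T F t) None = 1 - measure D {T 0<..} / real n"
  using measure_Some_image_sure[of "round_law n \<epsilon> T F t" "{T 0<..}"]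
    phase1_above_T0[OF assms] measure_round_law_phase1[OF assms order_refl] by simp

lemma phase2_above_T:
  "j < phase2_length n \<epsilon> \<Longrightarrow> Some r \<in> set_pmf (round_law n \<epsilon> T F (n + 2 + j)) \<Longrightarrow> T (j - 1) \<le> r"
  unfolding round_law_phase2 by (auto simp: find_Some_iff dest!: sym[of "Some r"])

lemma pmf_phase2_None:
  assumes "j < phase2_length n \<epsilon>"
  shows "pmf (round_law n \<epsilon> T F (n + 2 + j)) None = measure D {..<T (j - 1)}"
proof -
  have "pmf (round_law n \<epsilon> T F (n + 2 + j)) None = measure F {v. find (\<lambda>r. T (j - 1) \<le> r) v = None}"
    unfolding round_law_phase2[OF assms] by (simp add: pmf_map vimage_def)
  also have "\<dots> = measure F {v. Max (set v) < T (j - 1)}"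
  proof (rule measure_pmf.finite_measure_eq_AE, unfold AE_measure_pmf_iff)
    have "v \<noteq> []" if "v \<in> set_pmf F" for v
      using rd n_pos that by (auto simp: reward_distribution_def)
    then show "\<forall>v\<in>set_pmf F. v \<in> {v. find (\<lambda>r. T (j - 1) \<le> r) v = None}
        \<longleftrightarrow> v \<in> {v. Max (set v) < T (j - 1)}"
      by (auto simp: find_None_iff not_le)
  qed simp_all
  also have "\<dots> = measure D {..<T (j - 1)}"
    by (simp add: max_distribution_def vimage_def)
  finally show ?thesis .
qed

text \<open>A first-phase round selects above \<open>x\<close> with probability \<open>1 / n\<close>
  times the tail of the maximum, so it suffices that the expected number of first-phase rounds
  reached is at least \<open>n\<close>. Round \<open>n + 1\<close> makes up for the rounds lost to
  earlier selections.\<close>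

lemma tail_above_T0:
  assumes "T 0 \<le> x" "n + 1 \<le> k"
  shows "measure D {x<..} \<le> measure (measure_pmf (reward_law n \<epsilon> T F k)) (Some ` {x<..})"
proof -
  \<comment> \<open>The probability that one round selects; both factors of the bound
    \<open>1 / n^2\<close> matter below, since the expected loss is at most
    \<open>s * n * (n + 1) / 2\<close>, hence at most 1.\<close>
  define s where "s = measure D {T 0<..} / real n"
  have s: "0 \<le> s" "s * (real n * real n) \<le> 1"
    using above_T0 n_pos by (auto simp: s_def field_simps)
  have "s * 1 \<le> s * (real n * real n)"
    using n_pos s(1) mult_mono[of 1 "real n" 1 "real n"] by (intro mult_left_mono) auto
  then have "s \<le> 1" using s(2) by simp
  have gauss: "(\<Sum>i<n + 1. real i) * 2 = real n * (real n + 1)"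
    by (induction n) (simp_all add: algebra_simps)
  have "s * (real n * (real n + 1)) \<le> 2"
  proof -
    have "s * (real n * (real n + 1)) \<le> s * (real n * (real n + real n))"
      using n_pos s(1) by (intro mult_left_mono) auto
    then show ?thesis using s(2) by (simp add: algebra_simps)
  qed
  then have "(\<Sum>i<n + 1. real i) * s \<le> 1"
    unfolding gauss[symmetric] by (simp only: mult_ac)
  then have "real n \<le> (\<Sum>i<n + 1. 1 - real i * s)"
    unfolding sum_subtractf sum_distrib_right by simp
  also have "\<dots> \<le> (\<Sum>i<n + 1. (1 - s) ^ i)"
    using Bernoulli_inequality[of "- s"] \<open>s \<le> 1\<close> by (intro sum_mono) simp
  finally have geom: "real n \<le> (\<Sum>i<n + 1. (1 - s) ^ i)" .
  have "measure D {x<..} = real n * (measure D {x<..} / real n)"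
    using n_pos by simp
  also have "\<dots> \<le> (\<Sum>i<n + 1. (1 - s) ^ i) * (measure D {x<..} / real n)"
    using geom by (rule mult_right_mono) simp
  also have "\<dots> = measure (measure_pmf (reward_law n \<epsilon> T F (n + 1))) (Some ` {x<..})"
    unfolding reward_law_def sum_distrib_right
    by (subst measure_first_some)
       (auto simp: measure_round_law_phase1[OF _ assms(1)] pmf_phase1_None s_def intro!: sum.cong
         simp del: sum.lessThan_Suc)
  also have "\<dots> \<le> measure (measure_pmf (reward_law n \<epsilon> T F k)) (Some ` {x<..})"
    unfolding reward_law_def using assms(2) by (intro measure_first_some_mono) auto
  finally show ?thesis .
qed

text \<open>Round \<open>J\<close> fails with at most the probability bounding the joint failure of
  all rounds before it, so each round squares the bound. The second use of \<open>T 0\<close> starts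
  this doubling.\<close>

lemma prod_phase2_None_le:
  assumes "1 \<le> J" "J \<le> phase2_length n \<epsilon>"
  shows "(\<Prod>j<J. pmf (round_law n \<epsilon> T F (n + 2 + j)) None) \<le> p ^ (2 ^ (J - 1))"
  using assms
proof (induction J rule: dec_induct)
  case base
  then show ?case using pmf_phase2_None[of 0] by (simp add: p_def)
next
  case (step J)
  have "(\<Prod>j<Suc J. pmf (round_law n \<epsilon> T F (n + 2 + j)) None) \<le> p ^ (2 ^ (J - 1)) * p ^ (2 ^ (J - 1))"
    unfolding prod.lessThan_Suc
  proof (rule mult_mono)
    show "pmf (round_law n \<epsilon> T F (n + 2 + J)) None \<le> p ^ (2 ^ (J - 1))"
      using step below_T[of "J - 1"] by (subst pmf_phase2_None) auto
  qed (use step p_nonneg in auto)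
  also have "\<dots> = p ^ (2 ^ J)"
    using step(1) by (cases J) (simp_all add: mult_2 flip: power_add)
  finally show ?case by simp
qed

text \<open>All thresholds used in the first \<open>n + 1 + J\<close> rounds exceed
  \<open>x\<close>, so any selection made there does too and only the probability of selecting
  nothing has to be bounded.\<close>

lemma tail_below_T0:
  assumes x: "x < T 0" and J: "1 \<le> J" "J \<le> phase2_length n \<epsilon>" "n + 1 + J \<le> k"
    and above: "\<And>j. j < J \<Longrightarrow> x < T (j - 1)"
  shows "1 - p ^ (2 ^ (J - 1)) \<le> measure (measure_pmf (reward_law n \<epsilon> T F k)) (Some ` {x<..})"
proof -
  let ?N = "\<lambda>i. pmf (round_law n \<epsilon> T F (1 + i)) None"
  have "(\<Prod>i<n + 1 + J. ?N i) = (\<Prod>i<n + 1. ?N i) * (\<Prod>j<J. pmf (round_law n \<epsilon> T F (n + 2 + j)) None)"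
    unfolding prod_lessThan_add by (simp add: add_ac)
  \<comment> \<open>The first phase is simply bounded by 1; the second phase alone suffices.\<close>
  also have "\<dots> \<le> 1 * p ^ (2 ^ (J - 1))"
    by (intro mult_mono prod_phase2_None_le J prod_le_1 prod_nonneg) (simp_all add: pmf_le_1)
  finally have le: "1 - p ^ (2 ^ (J - 1)) \<le> 1 - (\<Prod>i<n + 1 + J. ?N i)" by simp
  also have "\<dots> \<le> measure (measure_pmf (reward_law n \<epsilon> T F k)) (Some ` {x<..})"
    unfolding reward_law_def
  proof (rule measure_first_some_ge)
    fix i assume i: "i < n + 1 + J"
    show "measure (measure_pmf (round_law n \<epsilon> T F (1 + i))) (Some ` {x<..}) = 1 - ?N i"
    proof (rule measure_Some_image_sure)
      fix r assume r: "Some r \<in> set_pmf (round_law n \<epsilon> T F (1 + i))"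
      show "r \<in> {x<..}"
      proof (cases "i < n + 1")
        case True
        then show ?thesis using phase1_above_T0[of "1 + i" r] r x by simp
      next
        case False
        then obtain j where ij: "i = n + 1 + j" using le_Suc_ex[of "n + 1" i] by auto
        then show ?thesis
          using phase2_above_T[of j r] above[of j] i r J by (simp add: add_ac)
      qed
    qed
  qed (use J in auto)
  finally show ?thesis .
qed

text \<open>Below \<open>T 0\<close>, stop at the first second-phase threshold that is at most
  \<open>x\<close>. The failure probability before it is at most the mass up to that threshold,
  hence at most that up to \<open>x\<close>, so nothing is lost. Only if every threshold exceeds
  \<open>x\<close> is \<epsilon> needed.\<close>

lemma tail_domination:
  assumes m: "1 \<le> phase2_length n \<epsilon>" and k: "n + 1 + phase2_length n \<epsilon> \<le> k"
    and \<epsilon>: "p ^ (2 ^ (phase2_length n \<epsilon> - 1)) \<le> \<epsilon>" "\<epsilon> \<le> 1"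
  shows "(1 - \<epsilon>) * measure D {x<..} \<le> measure (measure_pmf (reward_law n \<epsilon> T F k)) (Some ` {x<..})"
proof -
  have "0 \<le> p ^ (2 ^ (phase2_length n \<epsilon> - 1))" using p_nonneg by simp
  then have "0 \<le> \<epsilon>" using \<epsilon>(1) by simp
  have le: "(1 - \<epsilon>) * measure D {x<..} \<le> measure D {x<..}"
    using \<open>0 \<le> \<epsilon>\<close> by (intro mult_left_le_one_le) (auto simp: \<epsilon>)
  show ?thesis
  proof (cases "T 0 \<le> x")
    case True
    then show ?thesis using tail_above_T0[of x k] le k by simp
  next
    case False
    show ?thesis
    proof (cases "\<exists>j<phase2_length n \<epsilon>. T (j - 1) \<le> x")
      case True
      define J where "J = (LEAST j. T (j - 1) \<le> x)"
      from True obtain j where j: "j < phase2_length n \<epsilon>" "T (j - 1) \<le> x" by blast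
      have J: "T (J - 1) \<le> x" "J \<le> j"
        unfolding J_def using j(2) by (auto intro: LeastI Least_le)
      have "1 \<le> J" using J(1) False by (cases J) auto
      have "1 - p ^ (2 ^ (J - 1)) \<le> measure (measure_pmf (reward_law n \<epsilon> T F k)) (Some ` {x<..})"
      proof (rule tail_below_T0)
        fix i assume "i < J"
        then show "x < T (i - 1)" unfolding J_def using not_less_Least by fastforce
      qed (use False \<open>1 \<le> J\<close> J j k in auto)
      moreover have "p ^ (2 ^ (J - 1)) \<le> measure D {..x}"
        using upto_T[of "J - 1"] J(1) measure_pmf.finite_measure_mono[of "{..T (J - 1)}" "{..x}" "max_distribution F"]
        by auto
      ultimately show ?thesis using le by (simp add: measure_greaterThan_eq[of _ x])
    next
      case none: False
      have "1 - p ^ (2 ^ (phase2_length n \<epsilon> - 1)) \<le> measure (measure_pmf (reward_law n \<epsilon> T F k)) (Some ` {x<..})"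
        using none by (intro tail_below_T0) (use False m k in auto)
      moreover have "(1 - \<epsilon>) * measure D {x<..} \<le> (1 - \<epsilon>) * 1"
        using \<epsilon> by (intro mult_left_mono) auto
      ultimately show ?thesis using \<epsilon> by simp
    qed
  qed
qed

end

text \<open>Combine \<open>1 - 1 / n \<le> exp (- 1 / n)\<close> with
  \<open>2 ^ (m - 1) \<ge> n * log 2 (1 / \<epsilon>)\<close>; passing from the binary to the
  natural logarithm only helps.\<close>

lemma power_quantile_le:
  fixes p \<epsilon> :: real
  assumes p: "0 \<le> p" "p \<le> 1 - 1 / real n" and n: "1 \<le> n" and \<epsilon>: "0 < \<epsilon>" "\<epsilon> < 1"
    and m: "1 \<le> m" "log 2 (log 2 (1 / \<epsilon>)) + log 2 (real n) + 1 \<le> real m"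
  shows "p ^ (2 ^ (m - 1)) \<le> \<epsilon>"
proof -
  define l where "l = log 2 (1 / \<epsilon>)"
  have l: "0 < l" using \<epsilon> by (simp add: l_def)
  have "l * real n = 2 powr (log 2 l + log 2 (real n))"
    using l n by (simp add: powr_add)
  also have "\<dots> \<le> 2 powr real (m - 1)"
    using m by (intro powr_mono) (auto simp: l_def of_nat_diff)
  also have "\<dots> = 2 ^ (m - 1)" by (simp add: powr_realpow)
  finally have big: "l * real n \<le> 2 ^ (m - 1)" .
  have "ln (1 / \<epsilon>) * ln 2 \<le> ln (1 / \<epsilon>) * 1"
    using \<epsilon> ln_le_minus_one[of "2 :: real"] by (intro mult_left_mono) auto
  then have "ln (1 / \<epsilon>) \<le> l"
    by (simp add: l_def log_def field_simps)
  have "p ^ (2 ^ (m - 1)) \<le> exp (- 1 / real n) ^ (2 ^ (m - 1))"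
    using p exp_ge_add_one_self[of "- 1 / real n"] by (intro power_mono) auto
  also have "\<dots> = exp (- (2 ^ (m - 1) / real n))"
    by (simp flip: exp_of_nat_mult)
  also have "\<dots> \<le> exp (- ln (1 / \<epsilon>))"
  proof -
    have "ln (1 / \<epsilon>) * real n \<le> 2 ^ (m - 1)"
      using mult_right_mono[OF \<open>ln (1 / \<epsilon>) \<le> l\<close>, of "real n"] big by simp
    then show ?thesis using n by (simp add: pos_le_divide_eq)
  qed
  also have "\<dots> = \<epsilon>" using \<epsilon> by (simp add: ln_div)
  finally show ?thesis .
qed

section \<open>Hard instances\<close>

lemma Max_Cons_replicate_0: "0 \<le> a \<Longrightarrow> Max (set (a # replicate l (0 :: real))) = a"
  by (simp add: set_replicate_conv_if)

text \<open>Covers both instances of the lower bound: \<open>M = 1\<close> with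
  \<open>\<delta> = 0\<close> is the constant 1, while a large \<open>M\<close> with positive
  \<open>\<delta>\<close> makes all atoms small, so that no choice of quantile threshold can put
  much more mass at or above it than its level dictates.\<close>

definition nearly_constant :: "nat \<Rightarrow> nat \<Rightarrow> real \<Rightarrow> real list pmf" where
  "nearly_constant n M \<delta> =
    map_pmf (\<lambda>j. (1 + \<delta> * real j / real M) # replicate (n - 1) 0) (pmf_of_set {..<M})"

context
  fixes n M :: nat and \<delta> :: real
  assumes n: "1 \<le> n" and M: "0 < M" and \<delta>: "0 \<le> \<delta>"
begin

lemma set_pmf_nearly_constant:
  "set_pmf (nearly_constant n M \<delta>) = (\<lambda>j. (1 + \<delta> * real j / real M) # replicate (n - 1) 0) ` {..<M}"
  unfolding nearly_constant_def using M by (simp add: set_pmf_of_set lessThan_empty_iff)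

lemma reward_distribution_nearly_constant: "reward_distribution n (nearly_constant n M \<delta>)"
  unfolding reward_distribution_def
proof
  fix v assume "v \<in> set_pmf (nearly_constant n M \<delta>)"
  then obtain j where v: "v = (1 + \<delta> * real j / real M) # replicate (n - 1) 0" (is "v = ?a # _")
    unfolding set_pmf_nearly_constant by blast
  have a: "0 < ?a" using \<delta> by (simp add: add_pos_nonneg)
  then have Max: "Max (set v) = ?a" unfolding v by (intro Max_Cons_replicate_0) simp
  have "\<exists>!i. i < n \<and> v ! i = ?a"
  proof
    show "0 < n \<and> v ! 0 = ?a" using n by (simp add: v)
  next
    fix i assume "i < n \<and> v ! i = ?a"
    then show "i = 0" using a by (cases i) (auto simp: v)
  qed
  then show "length v = n \<and> (\<forall>r\<in>set v. 0 \<le> r) \<and> (\<exists>!i. i < n \<and> v ! i = Max (set v))"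
    using n a unfolding Max by (auto simp: v)
qed

lemma max_distribution_nearly_constant:
  "max_distribution (nearly_constant n M \<delta>) = map_pmf (\<lambda>j. 1 + \<delta> * real j / real M) (pmf_of_set {..<M})"
  unfolding max_distribution_def nearly_constant_def map_pmf_comp
  using \<delta> by (intro map_pmf_cong refl Max_Cons_replicate_0) simp

lemma expected_max_nearly_constant: "1 \<le> expected_max (nearly_constant n M \<delta>)"
proof -
  have "(1 :: ennreal) = (\<integral>\<^sup>+w. 1 \<partial>measure_pmf (max_distribution (nearly_constant n M \<delta>)))" by simp
  also have "\<dots> \<le> expected_max (nearly_constant n M \<delta>)"
    unfolding expected_max_def max_distribution_nearly_constant
    using \<delta> by (intro nn_integral_mono_AE) (auto simp: AE_measure_pmf_iff)
  finally show ?thesis .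
qed

lemma nearly_constant_le:
  assumes "v \<in> set_pmf (nearly_constant n M \<delta>)" "r \<in> set v"
  shows "r \<le> 1 + \<delta>"
proof -
  from assms obtain j where "j < M" "r = 1 + \<delta> * real j / real M \<or> r = 0"
    unfolding set_pmf_nearly_constant by (auto split: if_splits)
  moreover from \<open>j < M\<close> have "\<delta> * (real j / real M) \<le> \<delta> * 1"
    using \<delta> by (intro mult_left_mono) auto
  ultimately show ?thesis using \<delta> by auto
qed

lemma pmf_max_nearly_constant_le:
  assumes "0 < \<delta>"
  shows "pmf (max_distribution (nearly_constant n M \<delta>)) x \<le> 1 / real M"
proof -
  let ?S = "{..<M} \<inter> (\<lambda>j. 1 + \<delta> * real j / real M) -` {x}"
  have "pmf (max_distribution (nearly_constant n M \<delta>)) x = real (card ?S) / real M"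
    unfolding max_distribution_nearly_constant pmf_map
    using M by (subst measure_pmf_of_set) (auto simp: lessThan_empty_iff)
  moreover have "card ?S \<le> Suc 0"
    unfolding card_le_Suc0_iff_eq[OF finite_Int[OF disjI1[OF finite_lessThan]]]
    using assms M by (auto simp: field_simps)
  ultimately show ?thesis using M by (simp add: divide_right_mono)
qed

end

section \<open>Upper bound on the number of rounds\<close>

lemma sufficient_rounds_two_phase:
  assumes thr: "\<And>F. reward_distribution n F \<Longrightarrow> admissible_thresholds n F (T F)"
    and \<epsilon>: "0 < \<epsilon>" "\<epsilon> < 1" and m: "1 \<le> phase2_length n \<epsilon>"
  shows "sufficient_rounds n \<epsilon> (two_phase_algorithm n \<epsilon> T) (n + 1 + phase2_length n \<epsilon>)"
  unfolding sufficient_rounds_def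
proof (intro allI impI)
  fix F k assume rd: "reward_distribution n F" and k: "n + 1 + phase2_length n \<epsilon> \<le> k"
  interpret two_phase n \<epsilon> "T F" F
    by unfold_locales (use rd thr in auto)
  let ?value = "\<lambda>s. case s of None \<Rightarrow> 0 | Some r \<Rightarrow> (r :: real)"
  define E where "E = map_pmf ?value (reward_law n \<epsilon> (T F) F k)"
  have "log 2 (log 2 (1 / \<epsilon>)) + log 2 (real n) + 1 \<le> real (phase2_length n \<epsilon>)"
    unfolding phase2_length_def by linarith
  then have pow: "p ^ (2 ^ (phase2_length n \<epsilon> - 1)) \<le> \<epsilon>"
    using p_nonneg p_le n_pos \<epsilon> m by (intro power_quantile_le[of p n]) auto
  have "ennreal (1 - \<epsilon>) * expected_max F \<le> (\<integral>\<^sup>+w. ennreal w \<partial>measure_pmf E)"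
    unfolding expected_max_def
  proof (rule nn_integral_mono_tail)
    \<comment> \<open>Selecting nothing counts as 0, which never exceeds a nonnegative
      \<open>x\<close>.\<close>
    fix x :: real assume "0 \<le> x"
    then have "?value -` {x<..} = Some ` {x<..}"
      by (auto split: option.splits)
    then have "measure (measure_pmf E) {x<..} = measure (measure_pmf (reward_law n \<epsilon> (T F) F k)) (Some ` {x<..})"
      by (simp add: E_def)
    then show "(1 - \<epsilon>) * measure D {x<..} \<le> measure (measure_pmf E) {x<..}"
      using tail_domination[OF m k pow, of x] \<epsilon> by simp
  qed (use \<epsilon> in auto)
  also have "\<dots> = expected_reward (two_phase_algorithm n \<epsilon> T) F k"
    unfolding expected_reward_two_phase E_def by simp
  finally show "ennreal (1 - \<epsilon>) * expected_max F \<le> expected_reward (two_phase_algorithm n \<epsilon> T) F k" .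
qed

section \<open>Lower bound on the number of rounds\<close>

lemma set_pmf_round_law:
  assumes "Some r \<in> set_pmf (round_law n \<epsilon> T F t)"
  shows "\<exists>v\<in>set_pmf F. r \<in> set v"
proof -
  from assms obtain v where v: "v \<in> set_pmf F" "Some r \<in> set_pmf (two_phase_round n \<epsilon> T F t v)"
    unfolding round_law_def by auto
  have "r \<in> set v"
    using v(2) unfolding two_phase_round_def
    by (auto split: if_splits dest: set_pmf_phase1_round dest!: sym[of "Some r"] simp: find_Some_iff)
  with v(1) show ?thesis by blast
qed

lemma expected_reward_le:
  assumes "\<And>v r. v \<in> set_pmf F \<Longrightarrow> r \<in> set v \<Longrightarrow> r \<le> B" and "0 \<le> B"
  shows "expected_reward (two_phase_algorithm n \<epsilon> T) F k
    \<le> ennreal (B * (1 - pmf (reward_law n \<epsilon> (T F) F k) None))"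
proof -
  let ?q = "reward_law n \<epsilon> (T F) F k"
  have "expected_reward (two_phase_algorithm n \<epsilon> T) F k
      \<le> (\<integral>\<^sup>+s. ennreal B * indicator (UNIV - {None}) s \<partial>measure_pmf ?q)"
    unfolding expected_reward_two_phase
  proof (intro nn_integral_mono_AE, unfold AE_measure_pmf_iff, rule ballI)
    fix s assume s: "s \<in> set_pmf ?q"
    show "ennreal (case s of None \<Rightarrow> 0 | Some r \<Rightarrow> r) \<le> ennreal B * indicator (UNIV - {None}) s"
    proof (cases s)
      case (Some r)
      then obtain t where "Some r \<in> set_pmf (round_law n \<epsilon> (T F) F t)"
        using s unfolding reward_law_def by (blast dest: set_pmf_first_some)
      then have "r \<le> B" using set_pmf_round_law assms(1) by blast
      then show ?thesis using Some by (simp add: ennreal_leI)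
    qed simp
  qed
  also have "\<dots> = ennreal B * ennreal (1 - pmf ?q None)"
    using measure_pmf.prob_compl[of "{None}" ?q]
    by (simp add: nn_integral_cmult measure_pmf.emeasure_eq_measure measure_pmf_single)
  also have "\<dots> = ennreal (B * (1 - pmf ?q None))"
    using assms(2) by (simp add: ennreal_mult pmf_le_1)
  finally show ?thesis .
qed

text \<open>The maximum has mean at least 1 and no reward exceeds \<open>1 + \<delta>\<close>, so a
  large probability of selecting nothing in \<open>k\<close> rounds refutes every \<open>K\<close>
  up to \<open>k\<close>.\<close>

lemma not_sufficient_rounds:
  assumes F: "F = nearly_constant n M \<delta>" "1 \<le> n" "0 < M" "0 \<le> \<delta>" and \<epsilon>: "\<epsilon> < 1"
    and small: "(1 + \<delta>) * (1 - pmf (reward_law n \<epsilon> (T F) F k) None) < 1 - \<epsilon>" and "K \<le> k"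
  shows "\<not> sufficient_rounds n \<epsilon> (two_phase_algorithm n \<epsilon> T) K"
proof
  assume "sufficient_rounds n \<epsilon> (two_phase_algorithm n \<epsilon> T) K"
  then have "ennreal (1 - \<epsilon>) * expected_max F \<le> expected_reward (two_phase_algorithm n \<epsilon> T) F k"
    unfolding sufficient_rounds_def
    using reward_distribution_nearly_constant[of n M \<delta>] F \<open>K \<le> k\<close> by blast
  also have "\<dots> \<le> ennreal ((1 + \<delta>) * (1 - pmf (reward_law n \<epsilon> (T F) F k) None))"
    using F nearly_constant_le[of n M \<delta>] by (intro expected_reward_le) auto
  also have "\<dots> < ennreal (1 - \<epsilon>)"
    using small \<epsilon> by (simp add: ennreal_less_iff \<open>0 \<le> \<delta>\<close> pmf_le_1)
  also have "ennreal (1 - \<epsilon>) = ennreal (1 - \<epsilon>) * 1" by simp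
  also have "\<dots> \<le> ennreal (1 - \<epsilon>) * expected_max F"
    using expected_max_nearly_constant[of n M \<delta>] F by (intro mult_left_mono) auto
  finally show False by simp
qed

context two_phase
begin

lemma reward_law_None_eq_1:
  assumes "measure D {T 0<..} = 0" "k \<le> n + 1"
  shows "pmf (reward_law n \<epsilon> T F k) None = 1"
  unfolding reward_law_def pmf_first_some_None
  using assms by (intro prod.neutral) (auto simp: pmf_phase1_None)

text \<open>Each of the \<open>n + 1\<close> rounds selects with probability at most
  \<open>1 / n^2\<close>, and \<open>1 - (n + 1) / n^2\<close> is at least \<open>1 / 4\<close> for
  \<open>n \<ge> 2\<close>, with equality at 2.\<close>

lemma phase1_None_ge:
  assumes "2 \<le> n"
  shows "1 / 4 \<le> (\<Prod>i<n + 1. pmf (round_law n \<epsilon> T F (1 + i)) None)"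
proof -
  define s where "s = measure D {T 0<..} / real n"
  have s: "0 \<le> s" "s * (real n * real n) \<le> 1"
    using above_T0 n_pos by (auto simp: s_def field_simps)
  have "2 * real n \<le> real n * real n" "2 * 2 \<le> real n * real n"
    using assms by (intro mult_mono; simp)+
  then have n: "4 * (real n + 1) \<le> 3 * (real n * real n)" by simp
  have "s * (4 * (real n + 1)) \<le> s * (3 * (real n * real n))"
    using n s(1) by (rule mult_left_mono)
  then have "1 / 4 \<le> 1 + real (n + 1) * (- s)"
    using s(2) by (simp add: algebra_simps)
  also have "\<dots> \<le> (1 + (- s)) ^ (n + 1)"
  proof (rule Bernoulli_inequality)
    have "s * 1 \<le> s * (real n * real n)"
      using \<open>2 * 2 \<le> real n * real n\<close> s(1) by (intro mult_left_mono) auto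
    then show "- 1 \<le> - s" using s(2) by simp
  qed
  also have "\<dots> = (\<Prod>i<n + 1. pmf (round_law n \<epsilon> T F (1 + i)) None)"
  proof -
    have "(\<Prod>i<n + 1. pmf (round_law n \<epsilon> T F (1 + i)) None) = (\<Prod>i<n + 1. 1 + (- s))"
      by (rule prod.cong) (auto simp: pmf_phase1_None s_def)
    then show ?thesis by (simp only: prod_constant card_lessThan)
  qed
  finally show ?thesis .
qed

text \<open>Small atoms make the mass strictly below a quantile threshold almost equal to its level,
  so every round fails with a probability not much below the upper bound used before.\<close>

lemma reward_law_None_ge:
  assumes n: "2 \<le> n"
    and atoms: "\<And>x. pmf (max_distribution F) x \<le> 1 / (2 * 4 ^ (2 ^ m))"
  shows "2 / 4 ^ (2 ^ (m + 1)) \<le> pmf (reward_law n \<epsilon> T F (n + 1 + m)) None"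
proof -
  have lt: "measure D {..\<tau>} - 1 / (2 * 4 ^ (2 ^ m)) \<le> measure D {..<\<tau>}" for \<tau>
  proof -
    have "measure D {..\<tau>} = measure D ({..<\<tau>} \<union> {\<tau>})"
      by (rule arg_cong[where f = "measure D"]) auto
    also have "\<dots> = measure D {..<\<tau>} + measure D {\<tau>}"
      by (rule measure_pmf.finite_measure_Union) auto
    finally show ?thesis using atoms[of \<tau>] by (simp add: measure_pmf_single)
  qed
  have "(4 :: real) ^ 1 \<le> 4 ^ (2 ^ m)" by (rule power_increasing) simp_all
  then have "1 / (2 * 4 ^ (2 ^ m)) \<le> 1 / (8 :: real)"
    by (intro divide_left_mono) simp_all
  moreover have "1 / real n \<le> 1 / 2" using n by (simp add: field_simps)
  moreover have "1 - 1 / real n \<le> measure D {..T 0}"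
    using thr by (simp add: admissible_thresholds_def quantile_threshold_iff)
  \<comment> \<open>The level is at least \<open>1 / 2\<close> and an atom takes away at most
    \<open>1 / 8\<close>.\<close>
  ultimately have p: "1 / 4 \<le> p"
    using lt[of "T 0"] unfolding p_def by linarith
  \<comment> \<open>The exponent is weakened from \<open>2 ^ (j - 1)\<close> to
    \<open>2 ^ j\<close>, uniformly in \<open>j\<close>, so that the exponents sum to
    \<open>2 ^ l - 1\<close> in \<open>prod\<close>. The atom costs at most half of the
    bound.\<close>
  have phase2: "(1 / 4) ^ (2 ^ j) / 2 \<le> pmf (round_law n \<epsilon> T F (n + 2 + j)) None" if "j < m" for j
  proof (cases "j < phase2_length n \<epsilon>")
    case True
    have "(1 / 4 :: real) ^ (2 ^ j) \<le> (1 / 4) ^ (2 ^ (j - 1))"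
      by (rule power_decreasing) simp_all
    also have "\<dots> \<le> p ^ (2 ^ (j - 1))" using p by (intro power_mono) auto
    also have "\<dots> \<le> measure D {..T (j - 1)}" by (rule upto_T)
    finally have "(1 / 4 :: real) ^ (2 ^ j) - 1 / (2 * 4 ^ (2 ^ m)) \<le> measure D {..<T (j - 1)}"
      using lt[of "T (j - 1)"] by linarith
    moreover have "(1 / 4 :: real) ^ (2 ^ m) \<le> (1 / 4) ^ (2 ^ j)"
      using that by (intro power_decreasing[of "2 ^ j" "2 ^ m"]) simp_all
    then have "1 / (2 * 4 ^ (2 ^ m)) \<le> (1 / 4 :: real) ^ (2 ^ j) / 2"
      by (simp add: power_one_over)
    ultimately show ?thesis unfolding pmf_phase2_None[OF True] by linarith
  next
    case False
    have "(1 / 4 :: real) ^ (2 ^ j) \<le> 1" by (rule power_le_one) simp_all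
    moreover have "pmf (round_law n \<epsilon> T F (n + 2 + j)) None = 1"
      unfolding round_law_late[OF False[unfolded not_less]] by simp
    ultimately show ?thesis by linarith
  qed
  have prod: "(\<Prod>j<l. (1 / 4 :: real) ^ (2 ^ j) / 2) = 4 / (4 ^ (2 ^ l) * 2 ^ l)" for l
  proof (induction l)
    case (Suc l)
    have sq: "(4 :: real) ^ (2 ^ Suc l) = 4 ^ (2 ^ l) * 4 ^ (2 ^ l)"
      by (simp only: power_Suc[of 2 l] mult_2 power_add)
    show ?case
      unfolding prod.lessThan_Suc Suc.IH sq by (simp add: power_one_over)
  qed simp
  \<comment> \<open>The halves lost in the \<open>m\<close> rounds and the factor 2 of the claim are
    paid for by a second factor \<open>4 ^ (2 ^ m)\<close>, which raises the exponent to
    \<open>2 ^ (m + 1)\<close>.\<close>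
  have "2 * (2 :: real) ^ m \<le> 2 ^ (2 ^ m) * 2 ^ (2 ^ m)"
  proof (rule mult_mono)
    show "(2 :: real) \<le> 2 ^ (2 ^ m)"
      by (rule self_le_power) simp_all
    show "(2 :: real) ^ m \<le> 2 ^ (2 ^ m)"
      by (rule power_increasing[OF less_imp_le[OF less_exp]]) simp
  qed simp_all
  also have "\<dots> = (2 * 2) ^ (2 ^ m)" by (rule power_mult_distrib[symmetric])
  also have "\<dots> = 4 ^ (2 ^ m)" by (simp only: mult_2 numeral_Bit0[symmetric])
  finally have two: "2 * (2 :: real) ^ m \<le> 4 ^ (2 ^ m)" .
  have "2 / (4 :: real) ^ (2 ^ (m + 1)) = 2 / (4 ^ (2 ^ m) * 4 ^ (2 ^ m))"
    by (simp add: mult_2 power_add)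
  also have "\<dots> \<le> 2 / (4 ^ (2 ^ m) * (2 * 2 ^ m))"
    using two by (intro divide_left_mono mult_left_mono) simp_all
  also have "\<dots> = 1 / 4 * (\<Prod>j<m. (1 / 4) ^ (2 ^ j) / 2)"
    unfolding prod by simp
  also have "\<dots> \<le> (\<Prod>i<n + 1. pmf (round_law n \<epsilon> T F (1 + i)) None)
      * (\<Prod>j<m. pmf (round_law n \<epsilon> T F (n + 2 + j)) None)"
    by (intro mult_mono phase1_None_ge n prod_mono prod_nonneg conjI phase2) auto
  also have "\<dots> = pmf (reward_law n \<epsilon> T F (n + 1 + m)) None"
    unfolding reward_law_def pmf_first_some_None prod_lessThan_add by (simp add: add_ac)
  finally show ?thesis .
qed

end

text \<open>With constant maximum 1 and a positive level \<open>1 - 1 / n\<close>, the threshold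
  \<open>T 0\<close> is at least 1, and the strict test rejects everything in the first phase. For
  \<open>n = 1\<close> the level would be 0.\<close>

lemma sufficient_rounds_ge:
  assumes thr: "\<And>F. reward_distribution n F \<Longrightarrow> admissible_thresholds n F (T F)"
    and n: "2 \<le> n" and \<epsilon>: "0 < \<epsilon>" "\<epsilon> < 1"
    and suff: "sufficient_rounds n \<epsilon> (two_phase_algorithm n \<epsilon> T) K"
  shows "n + 2 \<le> K"
proof (rule ccontr)
  assume "\<not> n + 2 \<le> K"
  then have K: "K \<le> n + 1" by simp
  define F where "F = nearly_constant n 1 0"
  interpret two_phase n \<epsilon> "T F" F
    using reward_distribution_nearly_constant[of n 1 0] thr[of F] n
    by unfold_locales (auto simp: F_def)
  have D: "max_distribution F = return_pmf 1"
    unfolding F_def using n by (simp add: max_distribution_nearly_constant)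
  have "1 - 1 / real n \<le> indicator {..T F 0} 1"
    using thr by (simp add: admissible_thresholds_def quantile_threshold_iff D)
  moreover have "1 / real n < 1" using n by simp
  ultimately have "1 \<le> T F 0"
    by (cases "1 \<le> T F 0") simp_all
  then have "measure D {T F 0<..} = 0" by (simp add: D)
  then have "pmf (reward_law n \<epsilon> (T F) F (n + 1)) None = 1"
    by (rule reward_law_None_eq_1) simp
  then show False
    using not_sufficient_rounds[of F n 1 0 \<epsilon> T "n + 1" K] suff n \<epsilon> K F_def by simp
qed

lemma sufficient_rounds_gt:
  assumes thr: "\<And>F. reward_distribution n F \<Longrightarrow> admissible_thresholds n F (T F)"
    and n: "2 \<le> n" and \<epsilon>: "0 < \<epsilon>" "\<epsilon> < 1"
    and suff: "sufficient_rounds n \<epsilon> (two_phase_algorithm n \<epsilon> T) K"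
  shows "real n + log 2 (log 2 (1 / \<epsilon>)) < real K + 1"
proof (rule ccontr)
  assume le: "\<not> real n + log 2 (log 2 (1 / \<epsilon>)) < real K + 1"
  obtain m where K: "K = n + 1 + m"
    using sufficient_rounds_ge[OF assms] by (metis add.assoc le_Suc_ex one_add_one)
  have l: "0 < log 2 (1 / \<epsilon>)" using \<epsilon> by simp
  have "real (m + 2) \<le> log 2 (log 2 (1 / \<epsilon>))" using le K by simp
  then have "2 powr real (m + 2) \<le> log 2 (1 / \<epsilon>)"
    using l by (simp add: le_log_iff)
  then have "real (2 ^ (m + 2)) \<le> log 2 (1 / \<epsilon>)" 
    by (subst (asm) powr_realpow) simp_all
  then have "2 powr real (2 ^ (m + 2)) \<le> 1 / \<epsilon>"
    using \<epsilon> by (simp add: le_log_iff)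
  then have "(2 :: real) ^ (2 ^ (m + 2)) \<le> 1 / \<epsilon>" by (simp only: powr_realpow)
  also have "(2 :: real) ^ (2 ^ (m + 2)) = (2 ^ 2) ^ (2 ^ (m + 1))"
    by (simp only: power_mult[symmetric]) (simp add: mult.commute)
  finally have \<epsilon>': "\<epsilon> \<le> 1 / 4 ^ (2 ^ (m + 1))" using \<epsilon> by (simp add: field_simps)
  \<comment> \<open>Makes the atoms \<open>1 / M\<close> half of \<open>4 ^ (- 2 ^ m)\<close>, as
    the bound on selecting nothing requires.\<close>
  define M :: nat where "M = 2 * 4 ^ (2 ^ m)"
  define F where "F = nearly_constant n M \<epsilon>"
  have M: "0 < M" by (simp add: M_def)
  interpret two_phase n \<epsilon> "T F" F
    using reward_distribution_nearly_constant[of n M \<epsilon>] thr[of F] n M \<epsilon>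
    by unfold_locales (auto simp: F_def)
  have "2 * \<epsilon> \<le> 2 / 4 ^ (2 ^ (m + 1))" using \<epsilon>' by simp
  also have "\<dots> \<le> pmf (reward_law n \<epsilon> (T F) F K) None"
    unfolding K
  proof (rule reward_law_None_ge[OF n])
    show "pmf (max_distribution F) x \<le> 1 / (2 * 4 ^ (2 ^ m))" for x
      using pmf_max_nearly_constant_le[of n M \<epsilon> x] n M \<epsilon> by (simp add: F_def M_def)
  qed
  finally have "(1 + \<epsilon>) * (1 - pmf (reward_law n \<epsilon> (T F) F K) None) \<le> (1 + \<epsilon>) * (1 - 2 * \<epsilon>)"
    using \<epsilon> by (intro mult_left_mono) auto
  \<comment> \<open>With spread \<open>\<delta> = \<epsilon>\<close> the product is
    \<open>1 - \<epsilon> - 2 * \<epsilon>^2\<close>.\<close>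
  also have "\<dots> < 1 - \<epsilon>" using \<epsilon> by (simp add: algebra_simps)
  finally show False
    using not_sufficient_rounds[of F n M \<epsilon> \<epsilon> T K K] suff n \<epsilon> M F_def by simp
qed

section \<open>Asymptotics of the competition complexity\<close>

lemma is_competition_complexity_exists:
  assumes "sufficient_rounds n \<epsilon> A K" "0 < K"
  shows "\<exists>\<kappa>\<le>K. is_competition_complexity n \<epsilon> A \<kappa>"
proof -
  let ?P = "\<lambda>K. 0 < K \<and> sufficient_rounds n \<epsilon> A K"
  have "?P (LEAST K. ?P K)" by (rule LeastI[of ?P K]) (use assms in simp)
  then have "is_competition_complexity n \<epsilon> A (LEAST K. ?P K)"
    unfolding is_competition_complexity_def by (auto intro: Least_le)
  moreover have "(LEAST K. ?P K) \<le> K" by (rule Least_le) (use assms in simp)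
  ultimately show ?thesis by blast
qed

text \<open>The \<open>o(1)\<close> is taken as \<open>n + log log (1 / \<epsilon>)\<close> grows,
  jointly in both parameters; \<open>\<epsilon>\<^sub>0\<close> keeps the iterated logarithm bounded
  below. For \<open>n = 1\<close> one has \<open>p = 0\<close>, and a nonempty second phase selects
  surely in its first round whatever \<epsilon> is.\<close>

theorem theorem3p1:
  fixes T :: "nat \<Rightarrow> real \<Rightarrow> real list pmf \<Rightarrow> nat \<Rightarrow> real"
    and \<epsilon>\<^sub>0 \<eta> :: real
  assumes thresholds:
      "\<And>n \<epsilon> F. reward_distribution n F \<Longrightarrow> admissible_thresholds n F (T n \<epsilon> F)"
    and "0 < \<epsilon>\<^sub>0" and "\<epsilon>\<^sub>0 < 1" and "0 < \<eta>"
  shows "\<exists>N::real. \<forall>(n::nat) (\<epsilon>::real).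
           1 \<le> n \<longrightarrow> 0 < \<epsilon> \<longrightarrow> \<epsilon> \<le> \<epsilon>\<^sub>0 \<longrightarrow> N \<le> real n + log 2 (log 2 (1 / \<epsilon>)) \<longrightarrow>
           (\<exists>\<kappa>::nat. is_competition_complexity n \<epsilon> (two_phase_algorithm n \<epsilon> (T n \<epsilon>)) \<kappa> \<and>
              real \<kappa> \<le> (1 + \<eta>) * (real n + log 2 (log 2 (1 / \<epsilon>))) \<and>
              (2 \<le> n \<longrightarrow> (1 - \<eta>) * (real n + log 2 (log 2 (1 / \<epsilon>))) \<le> real \<kappa>))"
proof -
  define L\<^sub>0 where "L\<^sub>0 = log 2 (log 2 (1 / \<epsilon>\<^sub>0))"
  \<comment> \<open>The 4 collects the extra first-phase round, the 2 in the length of the second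
    phase and 1 for the ceiling; \<open>y - L\<^sub>0\<close> bounds \<open>n\<close>.\<close>
  have "\<forall>\<^sub>F y in at_top. 4 + log 2 (y - L\<^sub>0) \<le> \<eta> * y"
    using \<open>0 < \<eta>\<close> by real_asymp
  then obtain N\<^sub>0 where N\<^sub>0: "\<And>y. N\<^sub>0 \<le> y \<Longrightarrow> 4 + log 2 (y - L\<^sub>0) \<le> \<eta> * y"
    unfolding eventually_at_top_linorder by blast
  \<comment> \<open>The three entries serve the upper estimate, the additive 1 in the lower
    estimate, and the nonnegativity of \<open>L + log 2 n\<close>, which makes the second phase
    nonempty.\<close>
  define N where "N = Max {N\<^sub>0, 1 / \<eta>, 2 powr (- L\<^sub>0)}"
  show ?thesis
  proof (intro exI[of _ N] allI impI)
    fix n :: nat and \<epsilon> :: real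
    assume n: "1 \<le> n" and \<epsilon>: "0 < \<epsilon>" "\<epsilon> \<le> \<epsilon>\<^sub>0" and N: "N \<le> real n + log 2 (log 2 (1 / \<epsilon>))"
    define L where "L = log 2 (log 2 (1 / \<epsilon>))"
    define y where "y = real n + L"
    have y: "N\<^sub>0 \<le> y" "1 / \<eta> \<le> y" "2 powr (- L\<^sub>0) \<le> y"
      using N by (simp_all add: N_def y_def L_def)
    have "\<epsilon> < 1" using \<epsilon> \<open>\<epsilon>\<^sub>0 < 1\<close> by simp
    have "log 2 (1 / \<epsilon>\<^sub>0) \<le> log 2 (1 / \<epsilon>)"
      using \<epsilon> by (simp add: field_simps)
    moreover have "0 < log 2 (1 / \<epsilon>\<^sub>0)" using \<open>0 < \<epsilon>\<^sub>0\<close> \<open>\<epsilon>\<^sub>0 < 1\<close> by simp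
    ultimately have "L\<^sub>0 \<le> L" unfolding L_def L\<^sub>0_def by simp
    have "0 \<le> L + log 2 (real n)"
    proof (cases "0 \<le> L")
      case False
      then have "2 powr (- L\<^sub>0) \<le> real n" using y(3) by (simp add: y_def)
      then have "- L\<^sub>0 \<le> log 2 (real n)" using n by (simp add: le_log_iff)
      then show ?thesis using \<open>L\<^sub>0 \<le> L\<close> by simp
    qed (use n in simp)
    then have m: "1 \<le> phase2_length n \<epsilon>" "real (phase2_length n \<epsilon>) \<le> L + log 2 (real n) + 3"
      unfolding phase2_length_def L_def by linarith+
    have "log 2 (real n) \<le> log 2 (y - L\<^sub>0)"
      using n \<open>L\<^sub>0 \<le> L\<close> by (simp add: y_def)
    then have upper: "real (n + 1 + phase2_length n \<epsilon>) \<le> (1 + \<eta>) * y"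
      using m(2) N\<^sub>0[OF y(1)] by (simp add: y_def algebra_simps)
    have thr: "\<And>F. reward_distribution n F \<Longrightarrow> admissible_thresholds n F (T n \<epsilon> F)"
      using thresholds by blast
    obtain \<kappa> where \<kappa>: "\<kappa> \<le> n + 1 + phase2_length n \<epsilon>"
      "is_competition_complexity n \<epsilon> (two_phase_algorithm n \<epsilon> (T n \<epsilon>)) \<kappa>"
      using is_competition_complexity_exists
        [OF sufficient_rounds_two_phase[where T = "T n \<epsilon>", OF thr \<epsilon>(1) \<open>\<epsilon> < 1\<close> m(1)]] by auto
    have "real \<kappa> \<le> (1 + \<eta>) * y" using \<kappa>(1) upper by linarith
    moreover have "(1 - \<eta>) * y \<le> real \<kappa>" if "2 \<le> n"
    proof -
      have "y < real \<kappa> + 1"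
        unfolding y_def L_def
        by (rule sufficient_rounds_gt[where T = "T n \<epsilon>", OF thr that \<epsilon>(1) \<open>\<epsilon> < 1\<close>])
           (use \<kappa>(2) in \<open>auto simp: is_competition_complexity_def\<close>)
      moreover have "1 \<le> \<eta> * y" using y(2) \<open>0 < \<eta>\<close> by (simp add: field_simps)
      ultimately show ?thesis by (simp add: algebra_simps)
    qed
    ultimately show "\<exists>\<kappa>::nat. is_competition_complexity n \<epsilon> (two_phase_algorithm n \<epsilon> (T n \<epsilon>)) \<kappa> \<and>
        real \<kappa> \<le> (1 + \<eta>) * (real n + log 2 (log 2 (1 / \<epsilon>))) \<and>
        (2 \<le> n \<longrightarrow> (1 - \<eta>) * (real n + log 2 (log 2 (1 / \<epsilon>))) \<le> real \<kappa>)"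
      using \<kappa>(2) unfolding y_def L_def by blast
  qed
qed

end
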